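(* Let $\mathcal{E}$ be a basis of sets in $\Omega$ with the $A_1$ self-improvement property. Let $X$ be a Banach function space over $\Omega$ and suppose that $M^{\mathcal{E}}:X\to X$ is bounded. Then there exists a $q>1$ such that $M^{\mathcal{E}}_q:X\to X$ is bounded. If $\mathcal{E}$ has the sharp $A_1$ self-improvement property with constants $C_1,C_2>0$, then moreover the following holds: for every $q>1$ with $C_1q'\geq2\|M^{\mathcal{E}}\|_{X\to X}$ one has \[ M^{\mathcal{E}}_qf\leq C_2\sum_{k=0}^\infty\frac{(M^{\mathcal{E}})^{k+1}f}{(C_1q')^k} \] for every $f\in X$, and \[ \|M^{\mathcal{E}}_q\|_{X\to X}\leq2C_2\|M^{\mathcal{E}}\|_{X\to X}. \]
   Context: $(\Omega,|\cdot|)$ is a $\sigma$-finite measure space of positive measure; $L^0(\Omega)$ is the space of a.e. finite measurable functions; a weight is a measurable function with $0<w<\infty$ a.e.; $\frac1q+\frac1{q'}=1$. A basis of sets in $\Omega$ is a collection $\mathcal{E}$ of measurable sets $E$ with $0<|E|<\infty$ such that (i) $\bigcup_{E\in\mathcal{E}}E=\Omega$; (ii) for all $x_1,x_2\in\Omega$ there is $E\in\mathcal{E}$ with $x_1,x_2\in E$; (iii) there is a countable $\mathcal{E}'\subseteq\mathcal{E}$ such that for all $\varepsilon>0$ and $E\in\mathcal{E}$ there is $E'\in\mathcal{E}'$ with $E\subseteq E'$ and $|E'|\le(1+\varepsilon)|E|$. Set $\langle f\rangle_{p,E}=|E|^{-1/p}\|f\mathbf{1}_E\|_{L^p(\Omega)}$,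 $M^{\mathcal{E}}_pf=\sup_{E\in\mathcal{E}}\langle f\rangle_{p,E}\mathbf{1}_E$, $M^{\mathcal{E}}=M_1^{\mathcal{E}}$; $(M^{\mathcal{E}})^k$ is the $k$-fold iterate. $w\in A_1(\mathcal{E})$ iff there is $C>0$ with $M^{\mathcal{E}}w\le Cw$ a.e.; the smallest such $C$ is $[w]_1^{\mathcal{E}}$. $\mathcal{E}$ has the $A_1$ self-improvement property if for each $w\in A_1(\mathcal{E})$ there is $q>1$ with $w^q\in A_1(\mathcal{E})$. It has the sharp $A_1$ self-improvement property (with constants $C_1,C_2>0$) if for every $w\in A_1(\mathcal{E})$ and every $q>1$ with $C_1q'\ge[w]_1^{\mathcal{E}}$ one has $M_q^{\mathcal{E}}w\le C_2M^{\mathcal{E}}w$. A Banach function space over $\Omega$ is a vector space $X\subseteq L^0(\Omega)$ with a norm such that: (ideal) $f\in X$, $g\in L^0$, $|g|\le|f|$ imply $g\in X$, $\|g\|_X\le\|f\|_X$; (Fatou) $0\le f_n\uparrow f$, $f_n\in X$, $\sup_n\|f_n\|_X<\infty$ imply $f\in X$, $\|f\|_X=\sup_n\|f_n\|_X$; (saturation) every measurable set of positive measure contains a measurable $F$ of positive measure with $\mathbf{1}_F\in X$. *)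

theory Defs
  imports "HOL-Analysis.Analysis"
begin

text \<open>
  Conventions. Elements of \<open>L\<^sup>0\<close> are represented by measurable functions \<open>f :: 'a \<Rightarrow> 'b\<close>, where the
  sort \<open>{real_normed_field, euclidean_space}\<close> of \<open>'b\<close> is satisfied by both \<open>real\<close> and \<open>complex\<close>;
  functions that agree almost everywhere are not identified, so (in)equalities between functions
  are stated almost everywhere. Functions that are nonnegative and may take the value infinity
  (weights, maximal functions and their iterates) have values in \<open>ennreal\<close>.
\<close>

section \<open>Maximal operators\<close>

text \<open>Powers with an exponent \<open>p > 0\<close>; for such \<open>p\<close> the zeroth and infinite base are as expected.\<close>

definition ennpow :: "ennreal \<Rightarrow> real \<Rightarrow> ennreal" where
  "ennpow x p = (if x = \<infinity> then \<infinity> else ennreal (enn2real x powr p))"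

definition Lp_norm :: "'a measure \<Rightarrow> real \<Rightarrow> ('a \<Rightarrow> ennreal) \<Rightarrow> ennreal" where
  "Lp_norm M p g = ennpow (\<integral>\<^sup>+x. ennpow (g x) p \<partial>M) (1 / p)"

definition average :: "'a measure \<Rightarrow> real \<Rightarrow> ('a \<Rightarrow> ennreal) \<Rightarrow> 'a set \<Rightarrow> ennreal" where
  "average M p g E =
     ennreal (measure M E powr (- (1 / p))) * Lp_norm M p (\<lambda>x. g x * indicator E x)"

definition maximal :: "'a measure \<Rightarrow> 'a set set \<Rightarrow> real \<Rightarrow> ('a \<Rightarrow> ennreal) \<Rightarrow> 'a \<Rightarrow> ennreal" where
  "maximal M \<E> p g x = (SUP E\<in>\<E>. average M p g E * indicator E x)"

definition maximal_op ::
    "'a measure \<Rightarrow> 'a set set \<Rightarrow> real \<Rightarrow> ('a \<Rightarrow> 'b::real_normed_vector) \<Rightarrow> 'a \<Rightarrow> ennreal" where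
  "maximal_op M \<E> p f = maximal M \<E> p (\<lambda>x. ennreal (norm (f x)))"

section \<open>Bases of sets\<close>

locale basis_of_sets =
  fixes M :: "'a measure" and \<E> :: "'a set set"
  assumes basis_sets: "\<E> \<subseteq> sets M"
    and basis_measure: "\<And>E. E \<in> \<E> \<Longrightarrow> 0 < emeasure M E \<and> emeasure M E < \<infinity>"
    and basis_cover: "\<Union>\<E> = space M"
    and basis_pairs: "\<And>x y. x \<in> space M \<Longrightarrow> y \<in> space M \<Longrightarrow> \<exists>E\<in>\<E>. x \<in> E \<and> y \<in> E"
    and basis_countable: "\<exists>\<E>'\<subseteq>\<E>. countable \<E>' \<and>
      (\<forall>\<epsilon>>0. \<forall>E\<in>\<E>. \<exists>E'\<in>\<E>'. E \<subseteq> E' \<and> emeasure M E' \<le> ennreal (1 + \<epsilon>) * emeasure M E)"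

section \<open>Weights and self-improvement\<close>

definition weight :: "'a measure \<Rightarrow> ('a \<Rightarrow> ennreal) \<Rightarrow> bool" where
  "weight M w \<longleftrightarrow> w \<in> borel_measurable M \<and> (AE x in M. 0 < w x \<and> w x < \<infinity>)"

definition A1 :: "'a measure \<Rightarrow> 'a set set \<Rightarrow> ('a \<Rightarrow> ennreal) \<Rightarrow> bool" where
  "A1 M \<E> w \<longleftrightarrow> weight M w \<and>
     (\<exists>C::real. C > 0 \<and> (AE x in M. maximal M \<E> 1 w x \<le> ennreal C * w x))"

definition A1_const :: "'a measure \<Rightarrow> 'a set set \<Rightarrow> ('a \<Rightarrow> ennreal) \<Rightarrow> real" where
  "A1_const M \<E> w = Inf {C. C > 0 \<and> (AE x in M. maximal M \<E> 1 w x \<le> ennreal C * w x)}"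

definition A1_self_improvement :: "'a measure \<Rightarrow> 'a set set \<Rightarrow> bool" where
  "A1_self_improvement M \<E> \<longleftrightarrow>
     (\<forall>w. A1 M \<E> w \<longrightarrow> (\<exists>q>1. A1 M \<E> (\<lambda>x. ennpow (w x) q)))"

definition conjugate_exponent :: "real \<Rightarrow> real" where
  "conjugate_exponent q = q / (q - 1)"

lemma conjugate_exponent: "q > 1 \<Longrightarrow> 1 / q + 1 / conjugate_exponent q = 1"
  by (simp add: conjugate_exponent_def field_simps)

definition sharp_A1_self_improvement ::
    "'a measure \<Rightarrow> 'a set set \<Rightarrow> real \<Rightarrow> real \<Rightarrow> bool" where
  "sharp_A1_self_improvement M \<E> C1 C2 \<longleftrightarrow> C1 > 0 \<and> C2 > 0 \<and>
     (\<forall>w q. A1 M \<E> w \<longrightarrow> q > 1 \<longrightarrow> A1_const M \<E> w \<le> C1 * conjugate_exponent q \<longrightarrow>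
        (AE x in M. maximal M \<E> q w x \<le> ennreal C2 * maximal M \<E> 1 w x))"

section \<open>Banach function spaces\<close>

text \<open>Since functions are not identified when they agree almost everywhere, the norm is a seminorm
  whose kernel is the set of functions that vanish almost everywhere.\<close>

locale banach_function_space =
  fixes M :: "'a measure"
    and X :: "('a \<Rightarrow> 'b::{real_normed_field, euclidean_space}) set"
    and N :: "('a \<Rightarrow> 'b) \<Rightarrow> real"
  assumes measurable: "X \<subseteq> borel_measurable M"
    and zero_mem: "(\<lambda>x. 0) \<in> X"
    and add_mem: "\<And>f g. f \<in> X \<Longrightarrow> g \<in> X \<Longrightarrow> (\<lambda>x. f x + g x) \<in> X"
    and scale_mem: "\<And>c f. f \<in> X \<Longrightarrow> (\<lambda>x. c * f x) \<in> X"
    and norm_eq_0: "\<And>f. f \<in> X \<Longrightarrow> N f = 0 \<longleftrightarrow> (AE x in M. f x = 0)"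
    and norm_triangle: "\<And>f g. f \<in> X \<Longrightarrow> g \<in> X \<Longrightarrow> N (\<lambda>x. f x + g x) \<le> N f + N g"
    and norm_scale: "\<And>c f. f \<in> X \<Longrightarrow> N (\<lambda>x. c * f x) = norm c * N f"
    and ideal: "\<And>f g. f \<in> X \<Longrightarrow> g \<in> borel_measurable M \<Longrightarrow>
      (AE x in M. norm (g x) \<le> norm (f x)) \<Longrightarrow> g \<in> X \<and> N g \<le> N f"
    and fatou: "\<And>(u :: nat \<Rightarrow> 'a \<Rightarrow> real) v.
      (\<And>n. (\<lambda>x. of_real (u n x)) \<in> X) \<Longrightarrow> v \<in> borel_measurable M \<Longrightarrow>
      (AE x in M. (\<forall>n. 0 \<le> u n x \<and> u n x \<le> u (Suc n) x) \<and> (\<lambda>n. u n x) \<longlonglongrightarrow> v x) \<Longrightarrow>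
      bdd_above (range (\<lambda>n. N (\<lambda>x. of_real (u n x)))) \<Longrightarrow>
      (\<lambda>x. of_real (v x)) \<in> X \<and> N (\<lambda>x. of_real (v x)) = (SUP n. N (\<lambda>x. of_real (u n x)))"
    and saturation: "\<And>A. A \<in> sets M \<Longrightarrow> emeasure M A > 0 \<Longrightarrow>
      \<exists>F\<in>sets M. F \<subseteq> A \<and> emeasure M F > 0 \<and> indicator F \<in> X"

section \<open>Boundedness of operators\<close>

definition to_L0 :: "('a \<Rightarrow> ennreal) \<Rightarrow> 'a \<Rightarrow> 'b::real_normed_field" where
  "to_L0 g x = of_real (enn2real (g x))"

text \<open>Since \<open>enn2real \<infinity> = 0\<close>, finiteness almost everywhere has to be demanded separately.\<close>

definition op_bound :: "'a measure \<Rightarrow> ('a \<Rightarrow> 'b::real_normed_field) set \<Rightarrow> (('a \<Rightarrow> 'b) \<Rightarrow> real) \<Rightarrow>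
    (('a \<Rightarrow> 'b) \<Rightarrow> 'a \<Rightarrow> ennreal) \<Rightarrow> real \<Rightarrow> bool" where
  "op_bound M X N T C \<longleftrightarrow> C \<ge> 0 \<and>
     (\<forall>f\<in>X. (AE x in M. T f x < \<infinity>) \<and> to_L0 (T f) \<in> X \<and> N (to_L0 (T f)) \<le> C * N f)"

definition bounded_op :: "'a measure \<Rightarrow> ('a \<Rightarrow> 'b::real_normed_field) set \<Rightarrow> (('a \<Rightarrow> 'b) \<Rightarrow> real) \<Rightarrow>
    (('a \<Rightarrow> 'b) \<Rightarrow> 'a \<Rightarrow> ennreal) \<Rightarrow> bool" where
  "bounded_op M X N T \<longleftrightarrow> (\<exists>C. op_bound M X N T C)"

text \<open>Meaningful only for bounded operators.\<close>

definition op_norm :: "'a measure \<Rightarrow> ('a \<Rightarrow> 'b::real_normed_field) set \<Rightarrow> (('a \<Rightarrow> 'b) \<Rightarrow> real) \<Rightarrow>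
    (('a \<Rightarrow> 'b) \<Rightarrow> 'a \<Rightarrow> ennreal) \<Rightarrow> real" where
  "op_norm M X N T = Inf {C. op_bound M X N T C}"

end

theory Submission
  imports Defs
begin

text \<open>
  The proof is the Rubio de Francia algorithm. Write \<open>\<M>\<close> for the maximal operator with exponent
  one and let \<open>\<M>\<close> be bounded on \<open>X\<close> with bound \<open>A\<close>. For \<open>f \<in> X\<close> and \<open>K \<ge> 2 A\<close>, \<open>K > 0\<close>, the function
  \<open>w = \<Sum>k. \<M>\<^sup>k \<bar>f\<bar> / K\<^sup>k\<close> dominates \<open>\<bar>f\<bar>\<close>, lies in \<open>X\<close> with norm at most \<open>2 N f\<close> (geometric
  series), and satisfies \<open>\<M> w \<le> K w\<close>, because \<open>\<M>\<close> is countably subadditive and shifts the series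
  by one index. Moreover \<open>w > 0\<close>: any two points lie in a common set of the basis, so \<open>\<M> f\<close> is
  positive at every point unless \<open>f = 0\<close> almost everywhere. Apart from that trivial case, \<open>w\<close> is therefore an
  \<open>A\<^sub>1\<close> weight with constant at most \<open>K\<close> (lemma \<open>A1_rubio_de_francia\<close>).

  With the sharp self-improvement property and \<open>K = C\<^sub>1 q'\<close> this gives at once
  \<open>\<M>\<^sub>q f \<le> \<M>\<^sub>q w \<le> C\<^sub>2 \<M> w\<close>; the pointwise estimate is the subadditivity of \<open>\<M>\<close> applied to the
  series, and the norm estimate follows from \<open>N w \<le> 2 N f\<close>.

  In the qualitative statement the exponent that self-improvement yields depends on the weight, so
  one function must be made to serve for all exponents (lemma \<open>exists_bounded_maximal\<close>). If \<open>\<M>\<^sub>q\<close>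
  were unbounded for every \<open>q > 1\<close>, choose \<open>q\<^sub>n\<close> decreasing to one and \<open>f\<^sub>n \<in> X\<close> for which the bound
  \<open>4\<^sup>n\<close> fails for \<open>\<M>\<^bsub>q\<^sub>n\<^esub>\<close>, normalise, and apply the algorithm to \<open>\<Sum>n. 2\<^bsup>-n\<^esup> \<bar>f\<^sub>n\<bar>\<close>. The resulting weight \<open>w\<close>
  satisfies \<open>w\<^sup>r \<in> A\<^sub>1\<close> for some \<open>r > 1\<close>, hence \<open>\<M>\<^sub>r w \<le> D w\<close>, and \<open>\<bar>f\<^sub>n\<bar> \<le> 2\<^sup>n w\<close>. As soon as
  \<open>q\<^sub>n \<le> r\<close>, Jensen's inequality gives \<open>\<M>\<^bsub>q\<^sub>n\<^esub> f\<^sub>n \<le> 2\<^sup>n D w\<close>, whose norm is at most \<open>4\<^sup>n\<close> for large \<open>n\<close>.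

  Two supporting facts carry the measure theory. The maximal function is measurable because the
  countable subfamily of the basis already computes the supremum. Series of functions with summable
  norms converge in \<open>X\<close>: the Fatou property presupposes a finite limit, and finiteness is obtained
  from saturation (lemma \<open>ext_norm_le_SUP\<close>).
\<close>

section \<open>Powers of extended nonnegative numbers\<close>

lemma ennpow_ennreal: "0 \<le> x \<Longrightarrow> ennpow (ennreal x) p = ennreal (x powr p)"
  by (simp add: ennpow_def)

lemma ennpow_top [simp]: "ennpow top p = top"
  by (simp add: ennpow_def)

lemma ennpow_zero [simp]: "ennpow 0 p = 0"
  using ennpow_ennreal[of 0 p] by simp

lemma ennpow_one [simp]: "ennpow x 1 = x"
  by (cases x) (auto simp: ennpow_ennreal)

lemma ennpow_mono: "0 \<le> p \<Longrightarrow> x \<le> y \<Longrightarrow> ennpow x p \<le> ennpow y p"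
  by (cases x; cases y) (auto simp: ennpow_ennreal powr_mono2 top_unique)

lemma ennpow_cmult:
  assumes "0 < p" "0 \<le> c"
  shows "ennpow (ennreal c * x) p = ennreal (c powr p) * ennpow x p"
proof (cases "c = 0")
  case True
  then show ?thesis using assms by simp
next
  case False
  then show ?thesis using assms
    by (cases x) (auto simp: ennpow_ennreal ennreal_mult[symmetric] powr_mult ennreal_mult_top)
qed

lemma ennpow_ennpow: "ennpow (ennpow x p) r = ennpow x (p * r)"
  by (cases x) (auto simp: ennpow_ennreal powr_powr)

lemma measurable_ennpow [measurable]:
  assumes [measurable]: "f \<in> borel_measurable M"
  shows "(\<lambda>x. ennpow (f x) p) \<in> borel_measurable M"
  unfolding ennpow_def by measurable

lemma ennpow_indicator: "ennpow (y * indicator E x) p = ennpow y p * indicator E x"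
  by (simp add: indicator_def)

lemma divide_ennreal_eq_mult: "0 < r \<Longrightarrow> a / ennreal r = ennreal (1 / r) * a"
  by (simp add: divide_ennreal_def inverse_ennreal mult.commute inverse_eq_divide)

lemma ennreal_le_of_le_cmult:
  fixes a R :: ennreal
  assumes "\<And>c::real. 1 < c \<Longrightarrow> a \<le> ennreal c * R"
  shows "a \<le> R"
proof (cases R)
  case (real r)
  have "a \<noteq> top" using assms[of 2] real by (auto simp: ennreal_mult_eq_top_iff top_unique)
  then obtain b where b: "a = ennreal b" "0 \<le> b" by (cases a) auto
  have "(\<lambda>n. (1 + inverse (real (Suc n))) * r) \<longlonglongrightarrow> (1 + 0) * r"
    by (intro tendsto_intros LIMSEQ_inverse_real_of_nat)
  moreover have "b \<le> (1 + inverse (real (Suc n))) * r" for n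
    using assms[of "1 + inverse (real (Suc n))"] real b
    by (simp add: ennreal_mult[symmetric] del: of_nat_Suc ennreal_plus)
  ultimately show ?thesis
    using real b LIMSEQ_le_const[of _ r b] by auto
qed simp

text \<open>Weighted arithmetic-geometric mean inequality of \<open>x\<close> and \<open>1\<close>: the pointwise
  form of Jensen's inequality for a concave power.\<close>

lemma powr_le_affine:
  fixes x \<theta> :: real
  assumes "0 \<le> x" "0 < \<theta>" "\<theta> \<le> 1"
  shows "x powr \<theta> \<le> \<theta> * x + (1 - \<theta>)"
proof (cases "x = 0")
  case False
  have "x powr \<theta> * 1 powr (1 - \<theta>) \<le> \<theta> * x + (1 - \<theta>) * 1"
    using assms False by (intro Youngs_inequality_0) auto
  then show ?thesis by simp
qed (use assms in auto)

section \<open>The maximal operator of a basis\<close>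

context basis_of_sets
begin

lemma sets_basis [measurable]: "E \<in> \<E> \<Longrightarrow> E \<in> sets M"
  using basis_sets by auto

lemma emeasure_basis: "E \<in> \<E> \<Longrightarrow> emeasure M E = ennreal (measure M E)"
  using basis_measure[of E] by (intro emeasure_eq_ennreal_measure) auto

lemma measure_basis: "E \<in> \<E> \<Longrightarrow> 0 < measure M E"
  using basis_measure[of E] by (simp add: emeasure_basis)

text \<open>With the normalising factor under the outer power the average is a power mean
  with respect to the uniform distribution on \<open>E\<close>, so that means with different exponents can be
  compared.\<close>

lemma average_eq:
  assumes "E \<in> \<E>" "0 < p"
  shows "average M p g E =
    ennpow (ennreal (1 / measure M E) * (\<integral>\<^sup>+x. ennpow (g x) p * indicator E x \<partial>M)) (1 / p)"
  using measure_basis[OF assms(1)] assms(2)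
  by (simp add: average_def Lp_norm_def ennpow_indicator ennpow_cmult powr_minus_divide powr_divide)

lemma average_1:
  assumes "E \<in> \<E>"
  shows "average M 1 g E = ennreal (1 / measure M E) * (\<integral>\<^sup>+x. g x * indicator E x \<partial>M)"
  using average_eq[OF assms, of 1] by simp

lemma average_mono:
  assumes "E \<in> \<E>" "0 < p" "AE x in M. g x \<le> h x"
  shows "average M p g E \<le> average M p h E"
proof -
  have "(\<integral>\<^sup>+x. ennpow (g x) p * indicator E x \<partial>M) \<le> (\<integral>\<^sup>+x. ennpow (h x) p * indicator E x \<partial>M)"
    using assms(3) by (intro nn_integral_mono_AE)
      (auto elim!: eventually_mono intro!: mult_right_mono ennpow_mono assms(2)[THEN less_imp_le])
  then show ?thesis
    using assms by (auto simp: average_eq intro!: ennpow_mono mult_left_mono)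
qed

lemma average_cmult:
  assumes [measurable]: "g \<in> borel_measurable M" and "E \<in> \<E>" "0 < p" "0 \<le> c"
  shows "average M p (\<lambda>x. ennreal c * g x) E = ennreal c * average M p g E"
proof -
  have [measurable]: "E \<in> sets M" using assms by simp
  have "(\<integral>\<^sup>+x. ennpow (ennreal c * g x) p * indicator E x \<partial>M)
      = ennreal (c powr p) * (\<integral>\<^sup>+x. ennpow (g x) p * indicator E x \<partial>M)"
    using assms by (simp add: ennpow_cmult mult.assoc nn_integral_cmult)
  then have "average M p (\<lambda>x. ennreal c * g x) E = ennpow (ennreal (c powr p) *
      (ennreal (1 / measure M E) * (\<integral>\<^sup>+x. ennpow (g x) p * indicator E x \<partial>M))) (1 / p)"
    using assms by (simp only: average_eq mult.left_commute)
  also have "\<dots> = ennreal c * average M p g E"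
    using assms by (subst ennpow_cmult) (auto simp: average_eq powr_powr)
  finally show ?thesis .
qed

text \<open>
  Jensen's inequality, by way of a pointwise estimate: for any finite \<open>t\<close> above the \<open>q\<close>-mean,
  \<open>g\<^sup>p\<close> is bounded by an affine function of \<open>g\<^sup>q\<close> that takes the value \<open>t\<^sup>p\<close> at \<open>t\<^sup>q\<close>, and the estimate
  is averaged over \<open>E\<close>. Taking \<open>t\<close> strictly above the mean avoids dividing by a vanishing mean.
\<close>

lemma average_mono_exponent:
  assumes [measurable]: "g \<in> borel_measurable M" and E: "E \<in> \<E>" and p: "0 < p" "p \<le> q"
  shows "average M p g E \<le> average M q g E"
proof (rule dense_ge)
  fix z assume z: "average M q g E < z"
  have [measurable]: "E \<in> sets M" using E by simp
  define m where "m = measure M E"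
  have m: "0 < m" using E by (simp add: m_def measure_basis)
  define J where "J r = ennreal (1 / m) * (\<integral>\<^sup>+x. ennpow (g x) r * indicator E x \<partial>M)" for r
  have avg: "average M r g E = ennpow (J r) (1 / r)" if "0 < r" for r
    using that E by (simp add: average_eq J_def m_def)
  show "average M p g E \<le> z"
  proof (cases z)
    case (real t)
    have t: "0 < t" using real z by (cases "t = 0") auto
    define \<theta> where "\<theta> = p / q"
    have \<theta>: "0 < \<theta>" "\<theta> \<le> 1" using p by (auto simp: \<theta>_def)
    define a where "a = t powr p * \<theta> / t powr q"
    define b where "b = t powr p * (1 - \<theta>)"
    have ab: "0 \<le> a" "0 \<le> b" using \<theta> by (auto simp: a_def b_def)
    have young: "ennpow y p \<le> ennreal a * ennpow y q + ennreal b" for y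
    proof (cases y)
      case (real r)
      have "r powr p = t powr p * ((r / t) powr q) powr \<theta>"
        using t p real by (simp add: powr_powr \<theta>_def powr_divide)
      also have "\<dots> \<le> t powr p * (\<theta> * (r / t) powr q + (1 - \<theta>))"
        using \<theta> by (intro mult_left_mono powr_le_affine) auto
      also have "\<dots> = a * r powr q + b"
        using t real by (simp add: a_def b_def powr_divide algebra_simps)
      finally show ?thesis
        using real ab by (simp add: ennpow_ennreal ennreal_mult[symmetric] ennreal_plus[symmetric]
          del: ennreal_plus)
    next
      case top
      have "0 < a" using t \<theta> by (simp add: a_def)
      then show ?thesis using top by (simp add: ennreal_mult_top)
    qed
    have "(\<integral>\<^sup>+x. ennpow (g x) p * indicator E x \<partial>M)
        \<le> (\<integral>\<^sup>+x. ennreal a * (ennpow (g x) q * indicator E x) + ennreal b * indicator E x \<partial>M)"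
      using young by (intro nn_integral_mono) (auto simp: indicator_def)
    also have "\<dots> = ennreal a * (\<integral>\<^sup>+x. ennpow (g x) q * indicator E x \<partial>M) + ennreal b * ennreal m"
      using E by (simp add: nn_integral_add nn_integral_cmult emeasure_basis m_def)
    finally have "J p \<le> ennreal (1 / m) *
        (ennreal a * (\<integral>\<^sup>+x. ennpow (g x) q * indicator E x \<partial>M) + ennreal b * ennreal m)"
      unfolding J_def by (rule mult_left_mono) simp
    also have "\<dots> = ennreal a * J q + ennreal (1 / m) * (ennreal b * ennreal m)"
      by (simp add: distrib_left J_def mult_ac)
    also have "ennreal (1 / m) * (ennreal b * ennreal m) = ennreal b"
      using m ab by (simp add: ennreal_mult[symmetric])
    also have "ennreal a * J q + ennreal b \<le> ennreal a * ennreal (t powr q) + ennreal b"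
    proof (intro add_right_mono mult_left_mono)
      have "ennpow (ennpow (J q) (1 / q)) q \<le> ennpow (ennreal t) q"
        using z p avg[of q] real by (intro ennpow_mono) auto
      then show "J q \<le> ennreal (t powr q)"
        using p t by (simp add: ennpow_ennpow ennpow_ennreal)
    qed simp
    also have "\<dots> = ennreal (t powr p)"
      using t ab by (simp add: ennreal_mult[symmetric] ennreal_plus[symmetric] del: ennreal_plus)
        (simp add: a_def b_def algebra_simps)
    finally have "ennpow (J p) (1 / p) \<le> ennpow (ennreal (t powr p)) (1 / p)"
      using p by (intro ennpow_mono) auto
    then show ?thesis
      using p t real by (simp add: avg ennpow_ennreal powr_powr)
  qed simp
qed

lemma average_le_maximal: "E \<in> \<E> \<Longrightarrow> x \<in> E \<Longrightarrow> average M p g E \<le> maximal M \<E> p g x"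
  unfolding maximal_def by (rule SUP_upper2[of E]) auto

lemma maximal_least:
  "(\<And>E. E \<in> \<E> \<Longrightarrow> x \<in> E \<Longrightarrow> average M p g E \<le> y) \<Longrightarrow> maximal M \<E> p g x \<le> y"
  unfolding maximal_def by (rule SUP_least) (auto simp: indicator_def)

text \<open>Averages are integrals, so an inequality almost everywhere between functions
  yields an inequality between their maximal functions at every point.\<close>

lemma maximal_mono:
  assumes "0 < p" "AE x in M. g x \<le> h x"
  shows "maximal M \<E> p g x \<le> maximal M \<E> p h x"
  by (rule maximal_least) (rule order_trans[OF average_mono[OF _ assms] average_le_maximal])

lemma maximal_cong:
  assumes "0 < p" "AE x in M. g x = h x"
  shows "maximal M \<E> p g x = maximal M \<E> p h x"
  using assms by (intro antisym maximal_mono) (auto elim: eventually_mono)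

lemma maximal_cmult:
  assumes "g \<in> borel_measurable M" "0 < p" "0 \<le> c"
  shows "maximal M \<E> p (\<lambda>x. ennreal c * g x) x = ennreal c * maximal M \<E> p g x"
  using assms by (simp add: maximal_def average_cmult mult.assoc SUP_mult_left_ennreal)

lemma maximal_zero:
  assumes "0 < p" "AE x in M. g x = 0"
  shows "maximal M \<E> p g x = 0"
  using maximal_cong[OF assms] maximal_cmult[of "\<lambda>x. 0" p 0 x] assms(1) by simp

lemma maximal_mono_exponent:
  assumes "g \<in> borel_measurable M" "0 < p" "p \<le> q"
  shows "maximal M \<E> p g x \<le> maximal M \<E> q g x"
  by (rule maximal_least)
    (rule order_trans[OF average_mono_exponent[OF assms(1) _ assms(2,3)] average_le_maximal])

lemma maximal_suminf_le:
  fixes g :: "nat \<Rightarrow> 'a \<Rightarrow> ennreal"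
  assumes [measurable]: "\<And>k. g k \<in> borel_measurable M"
  shows "maximal M \<E> 1 (\<lambda>x. \<Sum>k. g k x) x \<le> (\<Sum>k. maximal M \<E> 1 (g k) x)"
proof (rule maximal_least)
  fix E assume E: "E \<in> \<E>" "x \<in> E"
  have [measurable]: "E \<in> sets M" using E by simp
  have "average M 1 (\<lambda>x. \<Sum>k. g k x) E = (\<Sum>k. average M 1 (g k) E)"
    using E by (simp add: average_1 nn_integral_suminf flip: ennreal_suminf_multc)
  also have "\<dots> \<le> (\<Sum>k. maximal M \<E> 1 (g k) x)"
    using E by (intro suminf_le average_le_maximal) auto
  finally show "average M 1 (\<lambda>x. \<Sum>k. g k x) E \<le> (\<Sum>k. maximal M \<E> 1 (g k) x)" .
qed

text \<open>The \<open>A\<^sub>1\<close> condition for \<open>w\<^sup>q\<close>, raised to the power \<open>1 / q\<close>, is a bound for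
  \<open>\<M>\<^sub>q w\<close> by \<open>w\<close> itself.\<close>

lemma maximal_le_of_A1:
  assumes "0 < q" "0 \<le> C"
    and "maximal M \<E> 1 (\<lambda>x. ennpow (w x) q) x \<le> ennreal C * ennpow (w x) q"
  shows "maximal M \<E> q w x \<le> ennreal (C powr (1 / q)) * w x"
proof (rule maximal_least)
  fix E assume E: "E \<in> \<E>" "x \<in> E"
  have "average M q w E = ennpow (average M 1 (\<lambda>x. ennpow (w x) q) E) (1 / q)"
    using E assms by (simp add: average_1 average_eq)
  also have "\<dots> \<le> ennpow (ennreal C * ennpow (w x) q) (1 / q)"
    using assms E by (intro ennpow_mono order_trans[OF average_le_maximal assms(3)]) auto
  also have "\<dots> = ennreal (C powr (1 / q)) * w x"
    using assms by (simp add: ennpow_cmult ennpow_ennpow)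
  finally show "average M q w E \<le> ennreal (C powr (1 / q)) * w x" .
qed

text \<open>
  An uncountable supremum of measurable functions need not be measurable. Here enlarging \<open>E\<close> to a
  member \<open>E'\<close> of the countable subfamily keeps every point of \<open>E\<close> and decreases the average at most
  by a factor arbitrarily close to one, so the supremum over the subfamily is the same.
\<close>

lemma borel_measurable_maximal [measurable]:
  assumes p: "0 < p"
  shows "maximal M \<E> p g \<in> borel_measurable M"
proof -
  obtain \<E>' where \<E>': "\<E>' \<subseteq> \<E>" "countable \<E>'"
    and approx: "\<And>\<epsilon> E. 0 < \<epsilon> \<Longrightarrow> E \<in> \<E> \<Longrightarrow>
      \<exists>E'\<in>\<E>'. E \<subseteq> E' \<and> emeasure M E' \<le> ennreal (1 + \<epsilon>) * emeasure M E"
    using basis_countable by meson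
  have "maximal M \<E> p g x = (SUP E\<in>\<E>'. average M p g E * indicator E x)" for x
  proof (rule antisym)
    show "maximal M \<E> p g x \<le> (SUP E\<in>\<E>'. average M p g E * indicator E x)"
    proof (rule maximal_least, rule ennreal_le_of_le_cmult)
      fix E and c :: real
      assume E: "E \<in> \<E>" "x \<in> E" and c: "1 < c"
      \<comment> \<open>The tolerance for \<open>E'\<close> is chosen such that its \<open>p\<close>-th root costs exactly the factor \<open>c\<close>.\<close>
      have cp: "1 < c powr p" using c p by (simp add: gr_one_powr)
      then have "\<exists>E'\<in>\<E>'. E \<subseteq> E' \<and> emeasure M E' \<le> ennreal (1 + (c powr p - 1)) * emeasure M E"
        using E by (intro approx) auto
      then obtain E' where E': "E' \<in> \<E>'" "E \<subseteq> E'"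
        and le: "emeasure M E' \<le> ennreal (c powr p) * emeasure M E" by auto
      have E'\<E>: "E' \<in> \<E>" using E' \<E>' by auto
      have le': "measure M E' \<le> c powr p * measure M E"
        using le E(1) E'\<E> by (simp add: emeasure_basis ennreal_mult[symmetric])
      have ratio: "1 / measure M E \<le> c powr p * (1 / measure M E')"
        using le' measure_basis[OF E(1)] measure_basis[OF E'\<E>] by (simp add: field_simps)
      define I where "I F = (\<integral>\<^sup>+x. ennpow (g x) p * indicator F x \<partial>M)" for F
      have "ennreal (1 / measure M E) * I E \<le> ennreal (c powr p * (1 / measure M E')) * I E'"
        using ratio E'(2) unfolding I_def
        by (intro mult_mono nn_integral_mono ennreal_leI) (auto simp: indicator_def)
      also have "\<dots> = ennreal (c powr p) * (ennreal (1 / measure M E') * I E')"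
        by (subst ennreal_mult) (auto simp: mult.assoc)
      finally have "ennpow (ennreal (1 / measure M E) * I E) (1 / p) \<le>
          ennpow (ennreal (c powr p) * (ennreal (1 / measure M E') * I E')) (1 / p)"
        using p by (intro ennpow_mono) auto
      also have "\<dots> = ennreal c * ennpow (ennreal (1 / measure M E') * I E') (1 / p)"
        using p c by (subst ennpow_cmult) (auto simp: powr_powr)
      finally have "average M p g E \<le> ennreal c * average M p g E'"
        using E E'\<E> p by (simp add: average_eq I_def)
      moreover have "average M p g E' \<le> (SUP E\<in>\<E>'. average M p g E * indicator E x)"
        using E E' by (intro SUP_upper2[of E']) auto
      ultimately show "average M p g E \<le> ennreal c * (SUP E\<in>\<E>'. average M p g E * indicator E x)"
        by (meson mult_left_mono order_trans zero_le)
    qed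
    show "(SUP E\<in>\<E>'. average M p g E * indicator E x) \<le> maximal M \<E> p g x"
      unfolding maximal_def by (rule SUP_subset_mono[OF \<E>'(1)]) simp
  qed
  then have eq: "maximal M \<E> p g = (\<lambda>x. SUP E\<in>\<E>'. average M p g E * indicator E x)" by (rule ext)
  have "(\<lambda>x. average M p g E * indicator E x) \<in> borel_measurable M" if "E \<in> \<E>'" for E
  proof -
    have [measurable]: "E \<in> sets M" using that \<E>' by auto
    show ?thesis by measurable
  qed
  then show ?thesis unfolding eq by (rule borel_measurable_SUP[OF \<E>'(2)])
qed

text \<open>
  If the maximal function vanished at \<open>x\<close>, then \<open>g\<close> would vanish almost everywhere on each of the
  countably many members of the subfamily that contain \<open>x\<close>, and these cover the whole space, since every
  point shares a set of the basis with \<open>x\<close>.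
\<close>

lemma maximal_pos:
  assumes [measurable]: "g \<in> borel_measurable M"
    and nonzero: "\<not> (AE x in M. g x = 0)" and x: "x \<in> space M"
  shows "0 < maximal M \<E> 1 g x"
proof (rule ccontr)
  assume "\<not> 0 < maximal M \<E> 1 g x"
  then have zero: "average M 1 g E = 0" if "E \<in> \<E>" "x \<in> E" for E
    using average_le_maximal[OF that, of 1 g] by (simp add: not_less)
  obtain \<E>' where \<E>': "\<E>' \<subseteq> \<E>" "countable \<E>'"
    and approx: "\<And>\<epsilon> E. 0 < \<epsilon> \<Longrightarrow> E \<in> \<E> \<Longrightarrow>
      \<exists>E'\<in>\<E>'. E \<subseteq> E' \<and> emeasure M E' \<le> ennreal (1 + \<epsilon>) * emeasure M E"
    using basis_countable by meson
  have "AE y in M. g y * indicator E y = 0" if E: "E \<in> \<E>'" "x \<in> E" for E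
  proof -
    have E\<E>: "E \<in> \<E>" using E \<E>' by auto
    then have [measurable]: "E \<in> sets M" by simp
    have "(\<integral>\<^sup>+y. g y * indicator E y \<partial>M) = 0"
      using zero[OF E\<E> E(2)] measure_basis[OF E\<E>] by (simp add: average_1 E\<E>)
    then show ?thesis by (subst (asm) nn_integral_0_iff_AE) auto
  qed
  then have "AE y in M. \<forall>E\<in>{E\<in>\<E>'. x \<in> E}. g y * indicator E y = 0"
    using \<E>'(2) by (subst AE_ball_countable) auto
  then have "AE y in M. g y = 0"
  proof (rule AE_mp, intro AE_I2 impI)
    fix y assume y: "y \<in> space M" and all: "\<forall>E\<in>{E\<in>\<E>'. x \<in> E}. g y * indicator E y = 0"
    obtain E where "E \<in> \<E>" "x \<in> E" "y \<in> E" using basis_pairs[OF x y] by auto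
    with approx[of 1 E] obtain E' where "E' \<in> \<E>'" "x \<in> E'" "y \<in> E'" by auto
    with all show "g y = 0" by (auto simp: indicator_def split: if_splits)
  qed
  with nonzero show False by simp
qed

end

section \<open>Norm bounds for extended nonnegative functions\<close>

context banach_function_space
begin

text \<open>
  The maximal functions have values in \<open>ennreal\<close>, while \<open>N\<close> measures finite functions with values in
  \<open>'b\<close>. This predicate says that the extended norm of \<open>g\<close> is at most \<open>c\<close>; as a bound it
  avoids assigning a value to functions outside \<open>X\<close>, and an operator bound becomes a single
  instance of it.
\<close>

definition ext_norm_le :: "('a \<Rightarrow> ennreal) \<Rightarrow> real \<Rightarrow> bool" where
  "ext_norm_le g c \<longleftrightarrow> (AE x in M. g x < \<infinity>) \<and> to_L0 g \<in> X \<and> N (to_L0 g) \<le> c"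

lemma measurable_to_L0 [measurable]:
  "g \<in> borel_measurable M \<Longrightarrow> (to_L0 g :: 'a \<Rightarrow> 'b) \<in> borel_measurable M"
  unfolding to_L0_def by measurable

lemma norm_nonneg: "f \<in> X \<Longrightarrow> 0 \<le> N f"
  using ideal[of f "\<lambda>x. 0"] norm_eq_0[OF zero_mem] by auto

lemma ext_norm_le_nonneg: "ext_norm_le g c \<Longrightarrow> 0 \<le> c"
  unfolding ext_norm_le_def using norm_nonneg by force

lemma ext_norm_le_mono:
  assumes "ext_norm_le h c" "g \<in> borel_measurable M" "AE x in M. g x \<le> h x" "c \<le> d"
  shows "ext_norm_le g d"
proof -
  have "AE x in M. norm (to_L0 g x :: 'b) \<le> norm (to_L0 h x :: 'b)"
    using assms(1,3) unfolding ext_norm_le_def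
    by (auto elim!: eventually_elim2 simp: to_L0_def enn2real_mono)
  with ideal[of "to_L0 h" "to_L0 g"] assms have "to_L0 g \<in> X \<and> N (to_L0 g) \<le> N (to_L0 h)"
    by (auto simp: ext_norm_le_def)
  moreover have "AE x in M. g x < \<infinity>"
    using assms(1,3) unfolding ext_norm_le_def by (auto elim!: eventually_elim2)
  ultimately show ?thesis using assms by (auto simp: ext_norm_le_def)
qed

lemma ext_norm_le_zero: "ext_norm_le (\<lambda>x. 0) 0"
  using zero_mem norm_eq_0[OF zero_mem] by (simp add: ext_norm_le_def to_L0_def[abs_def])

lemma ext_norm_le_norm:
  assumes "f \<in> X"
  shows "ext_norm_le (\<lambda>x. ennreal (norm (f x))) (N f)"
proof -
  have [measurable]: "f \<in> borel_measurable M" using assms measurable by auto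
  have "to_L0 (\<lambda>x. ennreal (norm (f x))) \<in> X \<and> N (to_L0 (\<lambda>x. ennreal (norm (f x)))) \<le> N f"
    by (rule ideal[OF assms]) (auto simp: to_L0_def)
  then show ?thesis by (simp add: ext_norm_le_def)
qed

lemma ext_norm_le_add:
  assumes "ext_norm_le g c" "ext_norm_le h d"
    and "g \<in> borel_measurable M" "h \<in> borel_measurable M"
  shows "ext_norm_le (\<lambda>x. g x + h x) (c + d)"
proof -
  let ?s = "\<lambda>x. to_L0 g x + to_L0 h x :: 'b"
  have s: "?s \<in> X" "N ?s \<le> c + d"
    using assms add_mem[of "to_L0 g" "to_L0 h"] norm_triangle[of "to_L0 g" "to_L0 h"]
    by (auto simp: ext_norm_le_def)
  have fin: "AE x in M. g x < \<infinity>" "AE x in M. h x < \<infinity>"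
    using assms by (auto simp: ext_norm_le_def)
  then have "AE x in M. to_L0 (\<lambda>x. g x + h x) x = ?s x"
    by eventually_elim (simp add: to_L0_def enn2real_plus)
  then have "to_L0 (\<lambda>x. g x + h x) \<in> X \<and> N (to_L0 (\<lambda>x. g x + h x)) \<le> N ?s"
    using assms by (intro ideal[OF s(1)]) (auto elim: eventually_mono)
  moreover have "AE x in M. g x + h x < \<infinity>"
    using fin by eventually_elim simp
  ultimately show ?thesis using s by (auto simp: ext_norm_le_def)
qed

lemma ext_norm_le_cmult:
  assumes "ext_norm_le g c" "0 \<le> r"
  shows "ext_norm_le (\<lambda>x. ennreal r * g x) (r * c)"
proof -
  have "to_L0 (\<lambda>x. ennreal r * g x) = (\<lambda>x. of_real r * (to_L0 g x :: 'b))"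
    using assms(2) by (auto simp: to_L0_def enn2real_mult)
  moreover have "AE x in M. ennreal r * g x < \<infinity>"
    using assms(1)[unfolded ext_norm_le_def, THEN conjunct1]
    by eventually_elim (simp add: ennreal_mult_less_top)
  ultimately show ?thesis
    using assms scale_mem[where f="to_L0 g" and c="of_real r"] norm_scale[where f="to_L0 g" and c="of_real r"]
    by (auto simp: ext_norm_le_def mult_left_mono)
qed

text \<open>The Fatou property, for an increasing sequence whose limit is known to be
  finite.\<close>

lemma ext_norm_le_SUP_finite:
  assumes [measurable]: "\<And>n. S n \<in> borel_measurable M"
    and inc: "\<And>n x. S n x \<le> S (Suc n) x"
    and le: "\<And>n. ext_norm_le (S n) c"
    and fin: "AE x in M. (SUP n. S n x) < \<infinity>"
  shows "ext_norm_le (\<lambda>x. SUP n. S n x) c"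
proof -
  define v where "v x = enn2real (SUP n. S n x)" for x
  have fatou_conv: "AE x in M. (\<forall>n. 0 \<le> enn2real (S n x) \<and> enn2real (S n x) \<le> enn2real (S (Suc n) x))
      \<and> (\<lambda>n. enn2real (S n x)) \<longlonglongrightarrow> v x"
    using fin
  proof eventually_elim
    case (elim x)
    have "S n x < top" for n
      using elim by (intro le_less_trans[OF SUP_upper[of n UNIV "\<lambda>n. S n x"]]) auto
    moreover have "(\<lambda>n. S n x) \<longlonglongrightarrow> (SUP n. S n x)"
      using inc by (intro LIMSEQ_SUP incseq_SucI)
    ultimately show ?case
      using inc elim unfolding v_def by (auto intro!: enn2real_mono tendsto_enn2real)
  qed
  have mem: "(\<lambda>x. of_real (enn2real (S n x))) \<in> X" "N (\<lambda>x. of_real (enn2real (S n x))) \<le> c" for n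
    using le[of n] by (auto simp: ext_norm_le_def to_L0_def[abs_def])
  have "(\<lambda>x. of_real (v x)) \<in> X \<and>
      N (\<lambda>x. of_real (v x)) = (SUP n. N (\<lambda>x. of_real (enn2real (S n x))))"
    by (rule fatou[OF mem(1) _ fatou_conv]) (auto simp: v_def intro!: mem bdd_aboveI)
  moreover have "(SUP n. N (\<lambda>x. of_real (enn2real (S n x)))) \<le> c"
    by (rule cSUP_least) (auto intro: mem)
  ultimately show ?thesis
    using fin by (simp add: ext_norm_le_def to_L0_def[abs_def] v_def)
qed

text \<open>
  The limit of a norm-bounded increasing sequence is finite almost everywhere: otherwise saturation
  provides a set \<open>F\<close> of positive measure on which the limit is infinite and whose indicator lies in \<open>X\<close>.
  Truncating the sequence at height \<open>m\<close> on \<open>F\<close> gives a finite limit \<open>m 1\<^sub>F\<close>, so \<open>m N 1\<^sub>F \<le> c\<close> for all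
  \<open>m\<close>, which forces \<open>N 1\<^sub>F = 0\<close> although \<open>F\<close> has positive measure.
\<close>

lemma ext_norm_le_SUP:
  assumes [measurable]: "\<And>n. S n \<in> borel_measurable M"
    and inc: "\<And>n x. S n x \<le> S (Suc n) x"
    and le: "\<And>n. ext_norm_le (S n) c"
  shows "ext_norm_le (\<lambda>x. SUP n. S n x) c"
proof (rule ext_norm_le_SUP_finite[where S=S, OF assms])
  define A where "A = {x \<in> space M. (SUP n. S n x) = \<infinity>}"
  have A [measurable]: "A \<in> sets M" unfolding A_def by measurable
  have "emeasure M A = 0"
  proof (rule ccontr)
    assume "emeasure M A \<noteq> 0"
    then obtain F where F [measurable]: "F \<in> sets M" and "F \<subseteq> A" and pos: "emeasure M F > 0"
      and FX: "indicator F \<in> X"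
      using saturation[OF A] by (auto simp: zero_less_iff_neq_zero)
    have scaled: "real m * N (indicator F) \<le> c" for m :: nat
    proof -
      define T where "T n x = min (S n x) (of_nat m) * indicator F x" for n x
      have T [measurable]: "T n \<in> borel_measurable M" for n unfolding T_def by measurable
      have eq: "(SUP n. T n x) = of_nat m * indicator F x" for x
      proof (cases "x \<in> F")
        case True
        then have "(SUP n. S n x) = top" using \<open>F \<subseteq> A\<close> by (auto simp: A_def)
        moreover have "(SUP n. inf (S n x) (of_nat m)) = inf (SUP n. S n x) (of_nat m)"
          by (rule SUP_inf[symmetric])
        ultimately have "(SUP n. min (S n x) (of_nat m)) = of_nat m"
          by (simp only: inf_top_left inf_min[symmetric])
        then show ?thesis using True by (simp add: T_def)
      qed (simp add: T_def)
      have "ext_norm_le (\<lambda>x. SUP n. T n x) c"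
      proof (rule ext_norm_le_SUP_finite)
        show "T n x \<le> T (Suc n) x" for n x
          unfolding T_def using inc[of n x] by (intro mult_right_mono min.mono) auto
        show "ext_norm_le (T n) c" for n
          by (rule ext_norm_le_mono[OF le[of n]]) (auto simp: T_def indicator_def)
        show "AE x in M. (SUP n. T n x) < \<infinity>"
          by (simp add: eq indicator_def ennreal_of_nat_eq_real_of_nat)
      qed simp
      then have "N (to_L0 (\<lambda>x. of_nat m * indicator F x)) \<le> c"
        by (simp add: ext_norm_le_def eq)
      moreover have "to_L0 (\<lambda>x. of_nat m * indicator F x) = (\<lambda>x. of_nat m * (indicator F x :: 'b))"
        by (auto simp: to_L0_def indicator_def ennreal_of_nat_eq_real_of_nat)
      ultimately show ?thesis
        using norm_scale[where c="of_nat m", OF FX] by simp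
    qed
    have "N (indicator F) \<noteq> 0"
    proof
      assume "N (indicator F) = 0"
      then have "AE x in M. (indicator F x :: 'b) = 0" using norm_eq_0[OF FX] by simp
      then have "AE x in M. x \<notin> F" by (auto elim!: eventually_mono simp: indicator_def split: if_splits)
      then have "emeasure M F = 0" using AE_iff_measurable[of F M "\<lambda>x. x \<notin> F"] sets.sets_into_space[OF F] by auto
      with pos show False by simp
    qed
    with norm_nonneg[OF FX] have "0 < N (indicator F)" by simp
    then obtain m :: nat where "c < real m * N (indicator F)" using reals_Archimedean3 by blast
    with scaled[of m] show False by simp
  qed
  then have "AE x in M. x \<notin> A" by (intro AE_not_in) auto
  then show "AE x in M. (SUP n. S n x) < \<infinity>"
    by (rule AE_mp) (intro AE_I2, simp add: A_def less_top[symmetric])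
qed

text \<open>The completeness of \<open>X\<close>, in the form of the Riesz--Fischer criterion for
  nonnegative series.\<close>

lemma ext_norm_le_suminf:
  assumes [measurable]: "\<And>k. g k \<in> borel_measurable M"
    and le: "\<And>k. ext_norm_le (g k) (a k)" and "summable a"
  shows "ext_norm_le (\<lambda>x. \<Sum>k. g k x) (\<Sum>k. a k)"
proof -
  have partial: "ext_norm_le (\<lambda>x. \<Sum>k<n. g k x) (\<Sum>k<n. a k)" for n
  proof (induction n)
    case 0
    show ?case using ext_norm_le_zero by simp
  next
    case (Suc n)
    then show ?case using ext_norm_le_add[OF Suc le[of n]] by simp
  qed
  have "ext_norm_le (\<lambda>x. SUP n. \<Sum>k<n. g k x) (\<Sum>k. a k)"
  proof (rule ext_norm_le_SUP)
    show "ext_norm_le (\<lambda>x. \<Sum>k<n. g k x) (\<Sum>k. a k)" for n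
      using assms(3) ext_norm_le_nonneg[OF le]
      by (intro ext_norm_le_mono[OF partial[of n]] sum_le_suminf) auto
  qed auto
  then show ?thesis by (simp add: suminf_eq_SUP)
qed

lemma op_bound_iff:
  "op_bound M X N T C \<longleftrightarrow> 0 \<le> C \<and> (\<forall>f\<in>X. ext_norm_le (T f) (C * N f))"
  by (auto simp: op_bound_def ext_norm_le_def)

lemma op_norm_le: "op_bound M X N T C \<Longrightarrow> op_norm M X N T \<le> C"
  unfolding op_norm_def by (rule cInf_lower) (auto simp: op_bound_def intro!: bdd_belowI[of _ 0])

text \<open>The infimum that defines the operator norm is attained.\<close>

lemma op_bound_op_norm:
  assumes "bounded_op M X N T"
  shows "op_bound M X N T (op_norm M X N T)"
proof -
  obtain C where C: "op_bound M X N T C" using assms by (auto simp: bounded_op_def)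
  have "0 \<le> op_norm M X N T"
    unfolding op_norm_def using C by (intro cInf_greatest) (auto simp: op_bound_def)
  moreover have "N (to_L0 (T f)) \<le> op_norm M X N T * N f" if f: "f \<in> X" for f
  proof (cases "N f = 0")
    case True
    then show ?thesis using C f by (auto simp: op_bound_def)
  next
    case False
    then have pos: "0 < N f" using norm_nonneg[OF f] by simp
    have "N (to_L0 (T f)) / N f \<le> op_norm M X N T"
      unfolding op_norm_def using C f pos
      by (intro cInf_greatest) (auto simp: op_bound_def pos_divide_le_eq)
    then show ?thesis using pos by (simp add: pos_divide_le_eq)
  qed
  ultimately show ?thesis using C by (auto simp: op_bound_def)
qed

end

section \<open>The Rubio de Francia algorithm\<close>

locale maximal_on_space = basis_of_sets M \<E> + banach_function_space M X N
  for M :: "'a measure" and \<E> and X :: "('a \<Rightarrow> 'b::{real_normed_field, euclidean_space}) set" and N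
begin

text \<open>Transfers an operator bound from \<open>X\<close> to extended functions, so that it can be
  iterated.\<close>

lemma ext_norm_le_maximal:
  assumes "op_bound M X N (maximal_op M \<E> p) A" "0 < p" "ext_norm_le g c"
  shows "ext_norm_le (maximal M \<E> p g) (A * c)"
proof -
  have g: "to_L0 g \<in> X" "N (to_L0 g) \<le> c" and fin: "AE x in M. g x < \<infinity>"
    using assms(3) by (auto simp: ext_norm_le_def)
  have "AE x in M. ennreal (norm (to_L0 g x :: 'b)) = g x"
    using fin by eventually_elim (simp add: to_L0_def)
  then have "maximal_op M \<E> p (to_L0 g :: 'a \<Rightarrow> 'b) = maximal M \<E> p g"
    unfolding maximal_op_def by (intro ext maximal_cong assms)
  moreover have "ext_norm_le (maximal_op M \<E> p (to_L0 g :: 'a \<Rightarrow> 'b)) (A * N (to_L0 g))" "0 \<le> A"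
    using assms(1) g by (auto simp: op_bound_iff)
  ultimately show ?thesis
    using g assms(2) by (auto intro: ext_norm_le_mono mult_left_mono)
qed

lemma iterate_measurable:
  "g \<in> borel_measurable M \<Longrightarrow> (maximal M \<E> 1 ^^ k) g \<in> borel_measurable M"
  by (cases k) auto

lemma ext_norm_le_iterate:
  assumes "op_bound M X N (maximal_op M \<E> 1) A" "ext_norm_le g c"
  shows "ext_norm_le ((maximal M \<E> 1 ^^ k) g) (A ^ k * c)"
proof (induction k)
  case (Suc k)
  then show ?case using ext_norm_le_maximal[OF assms(1) _ Suc] by (simp add: mult_ac)
qed (use assms in simp)

definition rubio_de_francia :: "real \<Rightarrow> ('a \<Rightarrow> ennreal) \<Rightarrow> 'a \<Rightarrow> ennreal" where
  "rubio_de_francia K g x = (\<Sum>k. (maximal M \<E> 1 ^^ k) g x / ennreal (K ^ k))"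

lemma rubio_de_francia_measurable [measurable]:
  assumes "g \<in> borel_measurable M"
  shows "rubio_de_francia K g \<in> borel_measurable M"
proof -
  note iterate_measurable[OF assms, measurable]
  show ?thesis unfolding rubio_de_francia_def[abs_def] by measurable
qed

lemma iterate_le_rubio_de_francia:
  "(maximal M \<E> 1 ^^ k) g x / ennreal (K ^ k) \<le> rubio_de_francia K g x"
  unfolding rubio_de_francia_def
  using sum_le_suminf[of "\<lambda>k. (maximal M \<E> 1 ^^ k) g x / ennreal (K ^ k)" "{k}"] by simp

lemma le_rubio_de_francia: "g x \<le> rubio_de_francia K g x"
  using iterate_le_rubio_de_francia[of 0 g x K] by (simp add: divide_ennreal_def)

lemma maximal_rubio_de_francia_le_suminf:
  assumes "g \<in> borel_measurable M" "0 < K"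
  shows "maximal M \<E> 1 (rubio_de_francia K g) x
    \<le> (\<Sum>k. (maximal M \<E> 1 ^^ (k + 1)) g x / ennreal (K ^ k))"
proof -
  note iterate_measurable[OF assms(1), measurable]
  have "maximal M \<E> 1 (\<lambda>x. \<Sum>k. (maximal M \<E> 1 ^^ k) g x / ennreal (K ^ k)) x
      \<le> (\<Sum>k. maximal M \<E> 1 (\<lambda>x. (maximal M \<E> 1 ^^ k) g x / ennreal (K ^ k)) x)"
    by (rule maximal_suminf_le) measurable
  also have "\<dots> = (\<Sum>k. (maximal M \<E> 1 ^^ (k + 1)) g x / ennreal (K ^ k))"
    using assms by (simp add: divide_ennreal_eq_mult maximal_cmult iterate_measurable)
  finally show ?thesis by (simp add: rubio_de_francia_def[abs_def])
qed

text \<open>Applying \<open>\<M>\<close> to the series and multiplying it by \<open>K\<close> both shift it by one index;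
  the right-hand side only has the additional term \<open>K g\<close>.\<close>

lemma maximal_rubio_de_francia_le:
  assumes "g \<in> borel_measurable M" "0 < K"
  shows "maximal M \<E> 1 (rubio_de_francia K g) x \<le> ennreal K * rubio_de_francia K g x"
proof -
  let ?t = "\<lambda>k. (maximal M \<E> 1 ^^ k) g x / ennreal (K ^ k)"
  have "maximal M \<E> 1 (rubio_de_francia K g) x
      \<le> (\<Sum>k. (maximal M \<E> 1 ^^ (k + 1)) g x / ennreal (K ^ k))"
    by (rule maximal_rubio_de_francia_le_suminf[OF assms])
  also have "\<dots> = (\<Sum>k. ennreal K * ?t (k + 1))"
  proof (rule suminf_cong)
    fix k
    have "ennreal (1 / K ^ k) = ennreal K * ennreal (1 / K ^ (k + 1))"
      using assms by (simp add: ennreal_mult[symmetric])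
    then show "(maximal M \<E> 1 ^^ (k + 1)) g x / ennreal (K ^ k) = ennreal K * ?t (k + 1)"
      using assms by (simp only: divide_ennreal_eq_mult zero_less_power mult.assoc)
  qed
  also have "\<dots> = ennreal K * (\<Sum>k. ?t (k + 1))"
    by simp
  also have "(\<Sum>k. ?t (k + 1)) \<le> rubio_de_francia K g x"
    unfolding rubio_de_francia_def using suminf_offset[of ?t 1] by simp
  finally show ?thesis by (simp add: mult_left_mono)
qed

text \<open>The \<open>k\<close>-th term has norm at most \<open>(A / K)\<^sup>k c\<close>, and \<open>A / K \<le> 1 / 2\<close>.\<close>

lemma ext_norm_le_rubio_de_francia:
  assumes A: "op_bound M X N (maximal_op M \<E> 1) A" and K: "0 < K" "2 * A \<le> K"
    and g: "g \<in> borel_measurable M" "ext_norm_le g c"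
  shows "ext_norm_le (rubio_de_francia K g) (2 * c)"
proof -
  note iterate_measurable[OF g(1), measurable]
  have "0 \<le> A" using A by (simp add: op_bound_def)
  define r where "r = A / K"
  have r: "0 \<le> r" "r \<le> 1 / 2" using \<open>0 \<le> A\<close> K by (auto simp: r_def field_simps)
  have "ext_norm_le (\<lambda>x. \<Sum>k. (maximal M \<E> 1 ^^ k) g x / ennreal (K ^ k)) (\<Sum>k. r ^ k * c)"
  proof (rule ext_norm_le_suminf)
    fix k
    have "ext_norm_le (\<lambda>x. ennreal (1 / K ^ k) * (maximal M \<E> 1 ^^ k) g x) (1 / K ^ k * (A ^ k * c))"
      using K by (intro ext_norm_le_cmult ext_norm_le_iterate[OF A] g) auto
    then show "ext_norm_le (\<lambda>x. (maximal M \<E> 1 ^^ k) g x / ennreal (K ^ k)) (r ^ k * c)"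
      using K by (simp add: divide_ennreal_eq_mult r_def power_divide)
    show "summable (\<lambda>k. r ^ k * c)"
      using r by (intro summable_mult2 summable_geometric) auto
  qed measurable
  moreover have "(\<Sum>k. r ^ k * c) \<le> 2 * c"
  proof -
    have "(\<Sum>k. r ^ k * c) = 1 / (1 - r) * c"
      using r by (subst suminf_mult2[symmetric]) (auto simp: suminf_geometric summable_geometric)
    also have "\<dots> \<le> 2 * c"
      using r ext_norm_le_nonneg[OF g(2)] by (intro mult_right_mono) (auto simp: field_simps)
    finally show ?thesis .
  qed
  ultimately have "ext_norm_le (rubio_de_francia K g) (\<Sum>k. r ^ k * c)"
    "(\<Sum>k. r ^ k * c) \<le> 2 * c" by (simp_all add: rubio_de_francia_def[abs_def])
  then show ?thesis
    using g by (auto intro: ext_norm_le_mono)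
qed

text \<open>Positivity comes from the term with index one, since \<open>g\<close> itself may have zeros
  while \<open>\<M> g\<close> has none.\<close>

lemma A1_rubio_de_francia:
  assumes A: "op_bound M X N (maximal_op M \<E> 1) A" and K: "0 < K" "2 * A \<le> K"
    and g: "g \<in> borel_measurable M" "ext_norm_le g c" and nonzero: "\<not> (AE x in M. g x = 0)"
  shows "A1 M \<E> (rubio_de_francia K g)" "A1_const M \<E> (rubio_de_francia K g) \<le> K"
proof -
  have "AE x in M. 0 < rubio_de_francia K g x"
  proof (rule AE_I2)
    fix x assume "x \<in> space M"
    then have "0 < maximal M \<E> 1 g x / ennreal K"
      using maximal_pos[OF g(1) nonzero] K by (simp add: divide_ennreal_eq_mult ennreal_zero_less_mult_iff)
    also have "\<dots> \<le> rubio_de_francia K g x"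
      using iterate_le_rubio_de_francia[of 1 g x K] by simp
    finally show "0 < rubio_de_francia K g x" .
  qed
  moreover have "AE x in M. rubio_de_francia K g x < \<infinity>"
    using ext_norm_le_rubio_de_francia[OF A K g] by (simp add: ext_norm_le_def)
  ultimately have "weight M (rubio_de_francia K g)"
    using g by (simp add: weight_def)
  moreover have bound: "AE x in M. maximal M \<E> 1 (rubio_de_francia K g) x \<le> ennreal K * rubio_de_francia K g x"
    using maximal_rubio_de_francia_le[OF g(1) K(1)] by simp
  ultimately show "A1 M \<E> (rubio_de_francia K g)" using K by (auto simp: A1_def)
  show "A1_const M \<E> (rubio_de_francia K g) \<le> K"
    unfolding A1_const_def using bound K by (intro cInf_lower bdd_belowI[of _ 0]) auto
qed

section \<open>Self-improvement of the maximal operator\<close>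

text \<open>
  By contradiction: the functions that witness the unboundedness for exponents tending to one are
  gathered in one series, so that a single weight and exponent deal with all but finitely many.
\<close>

lemma exists_bounded_maximal:
  assumes nontrivial: "emeasure M (space M) > 0"
    and improve: "A1_self_improvement M \<E>"
    and bounded: "bounded_op M X N (maximal_op M \<E> 1)"
  shows "\<exists>q>1. bounded_op M X N (maximal_op M \<E> q)"
proof (rule ccontr)
  assume contr: "\<not> (\<exists>q>1. bounded_op M X N (maximal_op M \<E> q))"
  obtain A where A: "op_bound M X N (maximal_op M \<E> 1) A"
    using bounded by (auto simp: bounded_op_def)
  \<comment> \<open>\<open>A\<close> is only known to be nonnegative, but \<open>K\<close> has to be positive.\<close>
  define K where "K = 2 * A + 1"
  have K: "0 < K" "2 * A \<le> K" using A by (auto simp: K_def op_bound_def)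
  define q where "q n = 1 + 1 / real (Suc n)" for n
  have q: "1 < q n" for n by (simp add: q_def)
  have "\<exists>f\<in>X. \<not> ext_norm_le (maximal_op M \<E> (q n) f) (4 ^ n * N f)" for n
    using contr q[of n] by (auto simp: bounded_op_def op_bound_iff)
  then obtain F where FX: "F n \<in> X"
    and F: "\<not> ext_norm_le (maximal_op M \<E> (q n) (F n)) (4 ^ n * N (F n))" for n
    by metis
  have pos: "0 < N (F n)" for n
  proof (rule ccontr)
    assume "\<not> 0 < N (F n)"
    then have 0: "N (F n) = 0" using norm_nonneg[OF FX[of n]] by simp
    then have "AE x in M. ennreal (norm (F n x)) = 0" using norm_eq_0[OF FX] by simp
    then have "maximal_op M \<E> (q n) (F n) = (\<lambda>x. 0)"
      using maximal_zero q[of n] by (auto simp: maximal_op_def)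
    then show False using F[of n] 0 ext_norm_le_zero by simp
  qed
  \<comment> \<open>The indicator of \<open>S\<close>, added to the series below, keeps \<open>g\<close> from vanishing almost everywhere.\<close>
  obtain S where S [measurable]: "S \<in> sets M" and S_pos: "emeasure M S > 0" and SX: "indicator S \<in> X"
    using saturation[OF sets.top nontrivial] by auto
  define a where "a n = 1 / (2 ^ n * N (F n))" for n
  have a: "0 < a n" for n using pos by (simp add: a_def)
  have F_meas [measurable]: "F n \<in> borel_measurable M" for n using FX measurable by auto
  define g where "g x = (\<Sum>n. ennreal (a n) * ennreal (norm (F n x))) + ennreal (norm (indicator S x :: 'b))" for x
  have g_meas: "g \<in> borel_measurable M"
    unfolding g_def[abs_def] by measurable
  have "ext_norm_le (\<lambda>x. \<Sum>n. ennreal (a n) * ennreal (norm (F n x))) (\<Sum>n. (1 / 2) ^ n)"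
  proof (rule ext_norm_le_suminf)
    fix n
    have "ext_norm_le (\<lambda>x. ennreal (a n) * ennreal (norm (F n x))) (a n * N (F n))"
      using a[of n] by (intro ext_norm_le_cmult ext_norm_le_norm FX) simp
    then show "ext_norm_le (\<lambda>x. ennreal (a n) * ennreal (norm (F n x))) ((1 / 2) ^ n)"
      using pos[of n] by (simp add: a_def power_divide)
  qed auto
  then have g_norm: "ext_norm_le g ((\<Sum>n. (1 / 2) ^ n) + N (indicator S))"
    unfolding g_def[abs_def] by (intro ext_norm_le_add ext_norm_le_norm SX) measurable
  have g_nonzero: "\<not> (AE x in M. g x = 0)"
  proof
    assume "AE x in M. g x = 0"
    then have "AE x in M. x \<notin> S"
      by eventually_elim (auto simp: g_def indicator_def split: if_splits)
    then have "emeasure M S = 0"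
      using AE_iff_measurable[of S M "\<lambda>x. x \<notin> S"] sets.sets_into_space[OF S] by auto
    with S_pos show False by simp
  qed
  define w where "w = rubio_de_francia K g"
  have w_meas: "w \<in> borel_measurable M" using g_meas by (simp add: w_def)
  obtain W where W: "ext_norm_le w W"
    using ext_norm_le_rubio_de_francia[OF A K g_meas g_norm] by (auto simp: w_def)
  obtain r where r: "1 < r" and "A1 M \<E> (\<lambda>x. ennpow (w x) r)"
    using improve A1_rubio_de_francia(1)[OF A K g_meas g_norm g_nonzero]
    unfolding A1_self_improvement_def w_def by auto
  then obtain C where "0 < C"
    and C: "AE x in M. maximal M \<E> 1 (\<lambda>x. ennpow (w x) r) x \<le> ennreal C * ennpow (w x) r"
    by (auto simp: A1_def)
  define D where "D = C powr (1 / r)"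
  have D: "0 \<le> D" by (simp add: D_def)
  have max_w: "AE x in M. maximal M \<E> r w x \<le> ennreal D * w x"
    using C by eventually_elim (use r \<open>0 < C\<close> in \<open>auto simp: D_def intro!: maximal_le_of_A1\<close>)
  have "eventually (\<lambda>n. q n < r) sequentially"
  proof -
    have "(\<lambda>n. 1 + inverse (real (Suc n))) \<longlonglongrightarrow> 1 + 0"
      by (intro tendsto_intros LIMSEQ_inverse_real_of_nat)
    then show ?thesis using r by (auto simp: q_def inverse_eq_divide dest!: order_tendstoD(2)[of _ _ _ r])
  qed
  moreover have "eventually (\<lambda>n. D * W \<le> 2 ^ n) sequentially"
  proof -
    obtain m where m: "D * W < 2 ^ m" using real_arch_pow[of 2 "D * W"] by auto
    have "D * W \<le> 2 ^ n" if "m \<le> n" for n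
      using m power_increasing[OF that, of "2::real"] by linarith
    then show ?thesis by (auto simp: eventually_sequentially)
  qed
  ultimately obtain n where n: "q n < r" "D * W \<le> 2 ^ n"
    using eventually_happens'[OF sequentially_bot eventually_conj] by blast
  let ?b = "2 ^ n * N (F n)"
  have b: "0 \<le> ?b" using pos[of n] by simp
  have F_le: "ennreal (norm (F n x)) \<le> ennreal ?b * w x" for x
  proof -
    have "ennreal (a n) * ennreal (norm (F n x)) \<le> (\<Sum>n. ennreal (a n) * ennreal (norm (F n x)))"
      using sum_le_suminf[of "\<lambda>n. ennreal (a n) * ennreal (norm (F n x))" "{n}"] by simp
    also have "\<dots> \<le> g x" by (simp add: g_def)
    also have "\<dots> \<le> w x" unfolding w_def by (rule le_rubio_de_francia)
    finally have "ennreal ?b * (ennreal (a n) * ennreal (norm (F n x))) \<le> ennreal ?b * w x"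
      by (rule mult_left_mono) simp
    moreover have "ennreal ?b * (ennreal (a n) * ennreal (norm (F n x))) = ennreal (norm (F n x))"
      using pos[of n] a[of n] by (simp add: ennreal_mult[symmetric] del: ennreal_mult) (simp add: a_def)
    ultimately show ?thesis by simp
  qed
  have max_le: "maximal_op M \<E> (q n) (F n) x \<le> ennreal ?b * maximal M \<E> r w x" for x
  proof -
    have "maximal_op M \<E> (q n) (F n) x \<le> maximal M \<E> (q n) (\<lambda>x. ennreal ?b * w x) x"
      unfolding maximal_op_def using q[of n] F_le by (intro maximal_mono) auto
    also have "\<dots> = ennreal ?b * maximal M \<E> (q n) w x"
      using q[of n] b w_meas by (intro maximal_cmult) auto
    also have "\<dots> \<le> ennreal ?b * maximal M \<E> r w x"
      using q[of n] n w_meas by (intro mult_left_mono maximal_mono_exponent) auto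
    finally show ?thesis .
  qed
  have "AE x in M. maximal_op M \<E> (q n) (F n) x \<le> ennreal ?b * (ennreal D * w x)"
    using max_w by eventually_elim (rule order_trans[OF max_le mult_left_mono], auto)
  moreover have "?b * (D * W) \<le> 4 ^ n * N (F n)"
  proof -
    have "?b * (D * W) \<le> ?b * 2 ^ n" by (rule mult_left_mono[OF n(2) b])
    also have "\<dots> = 4 ^ n * N (F n)" by (simp add: power_mult_distrib[symmetric])
    finally show ?thesis .
  qed
  moreover have "maximal_op M \<E> (q n) (F n) \<in> borel_measurable M"
    using q[of n] unfolding maximal_op_def[abs_def] by (intro borel_measurable_maximal) simp
  ultimately have "ext_norm_le (maximal_op M \<E> (q n) (F n)) (4 ^ n * N (F n))"
    using b D by (intro ext_norm_le_mono[OF ext_norm_le_cmult[OF ext_norm_le_cmult[OF W]]])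
  with F[of n] show False by simp
qed

text \<open>
  The series attached to \<open>f\<close> is a weight only if \<open>f\<close> does not vanish almost everywhere; in the
  remaining case \<open>\<M>\<^sub>q f = 0\<close>.
\<close>

lemma sharp_maximal_le:
  assumes A: "op_bound M X N (maximal_op M \<E> 1) A" and K: "0 < K" "2 * A \<le> K"
    and sharp: "sharp_A1_self_improvement M \<E> C1 C2"
    and q: "1 < q" "K = C1 * conjugate_exponent q"
    and f: "f \<in> X"
  shows "AE x in M. maximal_op M \<E> q f x \<le>
    ennreal C2 * maximal M \<E> 1 (rubio_de_francia K (\<lambda>y. ennreal (norm (f y)))) x"
proof (cases "AE x in M. ennreal (norm (f x)) = 0")
  case True
  then show ?thesis using q by (simp add: maximal_op_def maximal_zero)
next
  case False
  have g: "(\<lambda>y. ennreal (norm (f y))) \<in> borel_measurable M" using f measurable by auto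
  let ?w = "rubio_de_francia K (\<lambda>y. ennreal (norm (f y)))"
  have "A1 M \<E> ?w" "A1_const M \<E> ?w \<le> K"
    by (rule A1_rubio_de_francia[OF A K g ext_norm_le_norm[OF f] False])+
  with sharp q have "AE x in M. maximal M \<E> q ?w x \<le> ennreal C2 * maximal M \<E> 1 ?w x"
    unfolding sharp_A1_self_improvement_def by blast
  moreover have "maximal_op M \<E> q f x \<le> maximal M \<E> q ?w x" for x
    unfolding maximal_op_def using q by (intro maximal_mono) (auto intro: le_rubio_de_francia)
  ultimately show ?thesis by (auto elim!: eventually_mono intro: order_trans)
qed

lemma sharp_op_bound:
  assumes A: "op_bound M X N (maximal_op M \<E> 1) A" and K: "0 < K" "2 * A \<le> K"
    and sharp: "sharp_A1_self_improvement M \<E> C1 C2"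
    and q: "1 < q" "K = C1 * conjugate_exponent q"
  shows "op_bound M X N (maximal_op M \<E> q) (2 * C2 * A)"
  unfolding op_bound_iff
proof (intro conjI ballI)
  have C2: "0 \<le> C2" using sharp by (simp add: sharp_A1_self_improvement_def)
  then show "0 \<le> 2 * C2 * A" using A by (simp add: op_bound_def)
  fix f assume f: "f \<in> X"
  have g: "(\<lambda>y. ennreal (norm (f y))) \<in> borel_measurable M" using f measurable by auto
  have "ext_norm_le (\<lambda>x. ennreal C2 * maximal M \<E> 1 (rubio_de_francia K (\<lambda>y. ennreal (norm (f y)))) x)
      (C2 * (A * (2 * N f)))"
    by (intro ext_norm_le_cmult ext_norm_le_maximal[OF A] C2
        ext_norm_le_rubio_de_francia[OF A K g] ext_norm_le_norm f) simp
  then show "ext_norm_le (maximal_op M \<E> q f) (2 * C2 * A * N f)"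
    by (rule ext_norm_le_mono) (use q sharp_maximal_le[OF assms f] in
      \<open>auto simp: maximal_op_def[abs_def] intro!: borel_measurable_maximal\<close>)
qed

end

theorem theorem2p34:
  fixes M :: "'a measure" and \<E> :: "'a set set"
    and X :: "('a \<Rightarrow> 'b::{real_normed_field, euclidean_space}) set"
    and N :: "('a \<Rightarrow> 'b) \<Rightarrow> real"
  assumes "sigma_finite_measure M" and "emeasure M (space M) > 0"
    and "basis_of_sets M \<E>"
    and "A1_self_improvement M \<E>"
    and "banach_function_space M X N"
    and "bounded_op M X N (maximal_op M \<E> 1)"
  shows "(\<exists>q>1. bounded_op M X N (maximal_op M \<E> q)) \<and>
    (\<forall>C1 C2. sharp_A1_self_improvement M \<E> C1 C2 \<longrightarrow>
      (\<forall>q>1. C1 * conjugate_exponent q \<ge> 2 * op_norm M X N (maximal_op M \<E> 1) \<longrightarrow>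
        (\<forall>f\<in>X. AE x in M. maximal_op M \<E> q f x \<le>
           ennreal C2 * (\<Sum>k. ((maximal M \<E> 1) ^^ (k + 1)) (\<lambda>y. ennreal (norm (f y))) x
                              / ennreal ((C1 * conjugate_exponent q) ^ k))) \<and>
        bounded_op M X N (maximal_op M \<E> q) \<and>
        op_norm M X N (maximal_op M \<E> q) \<le> 2 * C2 * op_norm M X N (maximal_op M \<E> 1)))"
proof -
  interpret basis_of_sets M \<E> by fact
  interpret banach_function_space M X N by fact
  interpret maximal_on_space M \<E> X N ..
  show ?thesis
  proof (intro conjI allI impI)
    show "\<exists>q>1. bounded_op M X N (maximal_op M \<E> q)"
      by (rule exists_bounded_maximal[OF assms(2,4,6)])
  next
    fix C1 C2 q
    assume sharp: "sharp_A1_self_improvement M \<E> C1 C2" and q: "1 < q"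
      and le: "2 * op_norm M X N (maximal_op M \<E> 1) \<le> C1 * conjugate_exponent q"
    note A = op_bound_op_norm[OF assms(6)]
    let ?K = "C1 * conjugate_exponent q"
    have K: "0 < ?K" using sharp q by (simp add: sharp_A1_self_improvement_def conjugate_exponent_def)
    have bound: "op_bound M X N (maximal_op M \<E> q) (2 * C2 * op_norm M X N (maximal_op M \<E> 1))"
      by (rule sharp_op_bound[OF A K le sharp q refl])
    then show "bounded_op M X N (maximal_op M \<E> q)" by (auto simp: bounded_op_def)
    show "op_norm M X N (maximal_op M \<E> q) \<le> 2 * C2 * op_norm M X N (maximal_op M \<E> 1)"
      by (rule op_norm_le[OF bound])
    show "\<forall>f\<in>X. AE x in M. maximal_op M \<E> q f x \<le>
        ennreal C2 * (\<Sum>k. ((maximal M \<E> 1) ^^ (k + 1)) (\<lambda>y. ennreal (norm (f y))) x / ennreal (?K ^ k))"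
    proof
      fix f assume f: "f \<in> X"
      have g: "(\<lambda>y. ennreal (norm (f y))) \<in> borel_measurable M" using f measurable by auto
      show "AE x in M. maximal_op M \<E> q f x \<le>
        ennreal C2 * (\<Sum>k. ((maximal M \<E> 1) ^^ (k + 1)) (\<lambda>y. ennreal (norm (f y))) x / ennreal (?K ^ k))"
        using sharp_maximal_le[OF A K le sharp q refl f]
        by eventually_elim
          (rule order_trans[OF _ mult_left_mono[OF maximal_rubio_de_francia_le_suminf[OF g K]]], auto)
    qed
  qed
qed

end
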